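(* Let $N_a\ge1$ be an integer, $P_m>0$, $\rho>0$, and let $\mathbf{V}_m,\mathbf{Z}_{4,m}\in\mathbb{C}^{N_a\times N_a}$. Consider the problem $$\min_{\widetilde{\mathbf{V}}_m}\ \left\Vert\mathbf{V}_m-\widetilde{\mathbf{V}}_m+\rho\mathbf{Z}_{4,m}\right\Vert_F^2\quad\text{subject to}\quad \mathrm{Tr}(\widetilde{\mathbf{V}}_m)\le P_m,\ \ \widetilde{\mathbf{V}}_m\succeq\mathbf{0},$$ over $\widetilde{\mathbf{V}}_m\in\mathbb{C}^{N_a\times N_a}$. Let $$\mathbf{A}_m=\frac{\mathbf{V}_m+\rho\mathbf{Z}_{4,m}+\mathbf{V}_m^H+\rho\mathbf{Z}_{4,m}^H}{2},$$ let $y_{m,1},\dots,y_{m,N_a}$ be the eigenvalues of $\mathbf{A}_m$ and $\mathbf{U}_m$ a unitary matrix of corresponding eigenvectors, so that $\mathbf{A}_m=\mathbf{U}_m\mathrm{diag}(y_{m,1},\dots,y_{m,N_a})\mathbf{U}_m^H$. Then the optimal solution of the problem is $$\widetilde{\mathbf{V}}_m^\ast=\mathbf{U}_m\,\mathrm{diag}(x_{m,1}^\ast,\dots,x_{m,N_a}^\ast)\,\mathbf{U}_m^H,$$ where $$x_{m,n}^\ast=\begin{cases}\bar y_{m,n},& S_m\le P_m,\\ \max\{y_{m,n}-\tau,0\},& S_m>P_m,\end{cases}$$ with $\bar y_{m,n}=\max\{y_{m,n},0\}$, $S_m=\sum_{n=1}^{N_a}\bar y_{m,n}$, and $\tau$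 (in the case $S_m>P_m$) a positive number satisfying $\sum_{n=1}^{N_a}x_{m,n}^\ast=P_m$.
   Context: $\Vert\cdot\Vert_F$ is the Frobenius norm, $(\cdot)^H$ the conjugate transpose, and $\mathbf{X}\succeq\mathbf{0}$ means that $\mathbf{X}$ is Hermitian positive semidefinite. The index $m$ is fixed throughout. $P_m$ is a power budget, $\rho$ a penalty parameter and $\mathbf{Z}_{4,m}$ a dual variable; no structure (such as being Hermitian) is assumed on $\mathbf{V}_m$ or $\mathbf{Z}_{4,m}$. *)

theory Defs
  imports "HOL-Analysis.Analysis"
begin

definition adjoint_matrix :: "complex^'n^'m \<Rightarrow> complex^'m^'n"
  where "adjoint_matrix X = (\<chi> i j. cnj (X $ j $ i))"

definition unitary_matrix :: "complex^'n^'n \<Rightarrow> bool"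
  where "unitary_matrix U \<longleftrightarrow>
    adjoint_matrix U ** U = mat 1 \<and> U ** adjoint_matrix U = mat 1"

definition diag_matrix :: "('n \<Rightarrow> complex) \<Rightarrow> complex^'n^'n"
  where "diag_matrix d = (\<chi> i j. if i = j then d i else 0)"

(* The quadratic form of a Hermitian matrix is real-valued, so taking Re loses nothing. *)
definition psd_matrix :: "complex^'n^'n \<Rightarrow> bool"
  where "psd_matrix X \<longleftrightarrow>
    adjoint_matrix X = X \<and> (\<forall>z. 0 \<le> Re (\<Sum>i\<in>UNIV. cnj (z $ i) * (X *v z) $ i))"

definition frobenius_norm :: "complex^'n^'m \<Rightarrow> real"
  where "frobenius_norm X = sqrt (\<Sum>i\<in>UNIV. \<Sum>j\<in>UNIV. (cmod (X $ i $ j))\<^sup>2)"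

lemma frobenius_norm_eq_norm: "frobenius_norm X = norm X"
  by (simp add: frobenius_norm_def norm_vec_def L2_set_def sum_nonneg)

(* The trace of a Hermitian matrix is real, so the constraint on Re (trace X) is the
   constraint on the trace itself. *)
definition feasible :: "real \<Rightarrow> complex^'n^'n \<Rightarrow> bool"
  where "feasible P X \<longleftrightarrow> Re (trace X) \<le> P \<and> psd_matrix X"

definition objective ::
    "real \<Rightarrow> complex^'n^'n \<Rightarrow> complex^'n^'n \<Rightarrow> complex^'n^'n \<Rightarrow> real"
  where "objective \<rho> V Z X = (frobenius_norm (V - X + \<rho> *\<^sub>R Z))\<^sup>2"

definition A_matrix :: "real \<Rightarrow> complex^'n^'n \<Rightarrow> complex^'n^'n \<Rightarrow> complex^'n^'n"
  where "A_matrix \<rho> V Z =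
    (1 / 2) *\<^sub>R (V + \<rho> *\<^sub>R Z + adjoint_matrix V + \<rho> *\<^sub>R adjoint_matrix Z)"

definition pos_sum :: "('n::finite \<Rightarrow> real) \<Rightarrow> real"
  where "pos_sum y = (\<Sum>n\<in>UNIV. max (y n) 0)"

(* The threshold \<tau> only matters when the positive parts exceed the budget. *)
definition x_opt :: "('n::finite \<Rightarrow> real) \<Rightarrow> real \<Rightarrow> real \<Rightarrow> 'n \<Rightarrow> real"
  where "x_opt y P \<tau> n = (if pos_sum y \<le> P then max (y n) 0 else max (y n - \<tau>) 0)"

end

theory Submission
  imports Defs
begin

text \<open>
  Since \<open>inner\<close> on complex matrices is the real Frobenius inner product, the problem is a metric
  projection onto a convex set. The feasible matrices are Hermitian, so only the Hermitian part
  \<open>A\<close> of the target matters. Conjugating by the unitary \<open>U\<close>, which preserves inner product, trace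
  and semidefiniteness, turns the variational inequality into one between the diagonals:
  \<open>\<Sum>n. (y n - x n) * (x n - w n) \<ge> 0\<close> for all \<open>w \<ge> 0\<close> with \<open>\<Sum>n. w n \<le> P\<close>, which the water-filling
  vector \<open>x\<close> satisfies. The inequality gives
  \<open>objective X \<ge> objective X\<^sub>0 + (norm (X\<^sub>0 - X))\<^sup>2\<close>
  for the claimed minimiser \<open>X\<^sub>0\<close> and every feasible \<open>X\<close>, hence both optimality and uniqueness.
\<close>

section \<open>Adjoints and the real Frobenius inner product\<close>

lemma adjoint_matrix_adjoint [simp]: "adjoint_matrix (adjoint_matrix X) = X"
  by (simp add: adjoint_matrix_def vec_eq_iff)

lemma adjoint_matrix_mult:
  "adjoint_matrix (X ** Y) = adjoint_matrix Y ** adjoint_matrix X"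
  by (simp add: adjoint_matrix_def matrix_matrix_mult_def vec_eq_iff cnj_sum mult.commute)

lemma adjoint_matrix_diff: "adjoint_matrix (X - Y) = adjoint_matrix X - adjoint_matrix Y"
  by (simp add: adjoint_matrix_def vec_eq_iff)

lemma adjoint_diag_matrix_of_real [simp]:
  "adjoint_matrix (diag_matrix (\<lambda>n. complex_of_real (d n))) = diag_matrix (\<lambda>n. complex_of_real (d n))"
  by (auto simp: adjoint_matrix_def diag_matrix_def vec_eq_iff)

lemma congruence_diff:
  fixes W X Y :: "complex^'n^'n"
  shows "W ** (X - Y) ** T = W ** X ** T - W ** Y ** T"
  by (simp add: matrix_matrix_mult_def vec_eq_iff algebra_simps sum_subtractf)

lemma trace_diag_matrix: "trace (diag_matrix d) = (\<Sum>n\<in>UNIV. d n)"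
  by (simp add: trace_def diag_matrix_def)

lemma inner_complex_eq_Re: "inner a b = Re (cnj a * b)"
  by (simp add: inner_complex_def)

text \<open>In trace form, moving a factor across \<open>inner\<close> reduces to associativity of
  the matrix product.\<close>

lemma inner_matrix_eq_Re_trace:
  fixes X Y :: "complex^'n^'m"
  shows "inner X Y = Re (trace (adjoint_matrix X ** Y))"
  unfolding trace_def matrix_matrix_mult_def adjoint_matrix_def inner_vec_def
    inner_complex_eq_Re
  by (simp only: vec_lambda_beta Re_sum) (rule sum.swap)

lemma inner_adjoint_matrix:
  "inner (adjoint_matrix X) (adjoint_matrix Y) = inner X Y"
  unfolding inner_vec_def adjoint_matrix_def
  by (subst sum.swap) (simp add: inner_complex_def)

lemma inner_matrix_mult_left:
  fixes W X Y :: "complex^'n^'n"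
  shows "inner (W ** X) Y = inner X (adjoint_matrix W ** Y)"
  by (simp add: inner_matrix_eq_Re_trace adjoint_matrix_mult matrix_mul_assoc)

text \<open>Taking adjoints of both arguments preserves \<open>inner\<close> and turns right
  multiplication into left multiplication.\<close>

lemma inner_matrix_mult_right:
  fixes W X Y :: "complex^'n^'n"
  shows "inner (X ** W) Y = inner X (Y ** adjoint_matrix W)"
  by (metis adjoint_matrix_mult inner_adjoint_matrix inner_matrix_mult_left)

lemma inner_congruence:
  fixes U X Y :: "complex^'n^'n"
  shows "inner (U ** X ** adjoint_matrix U) Y = inner X (adjoint_matrix U ** Y ** U)"
  by (simp only: inner_matrix_mult_right[of "U ** X"] inner_matrix_mult_left[of U]
      adjoint_matrix_adjoint matrix_mul_assoc)

lemma inner_matrix_vector_left: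
  fixes W :: "complex^'n^'m"
  shows "inner (W *v z) w = inner z (adjoint_matrix W *v w)"
  unfolding inner_vec_def inner_complex_eq_Re matrix_vector_mult_def adjoint_matrix_def
  by (simp add: Re_sum[symmetric] cnj_sum sum_distrib_left sum_distrib_right mult_ac
      del: Re_sum) (subst sum.swap, rule refl)

text \<open>Off-diagonal entries of \<open>X\<close> meet zeros. This is what reduces the matrix
  inequality to one between real vectors.\<close>

lemma inner_diag_matrix:
  fixes X :: "complex^'n^'n"
  shows "inner (diag_matrix (\<lambda>n. complex_of_real (d n))) X = (\<Sum>n\<in>UNIV. d n * Re (X $ n $ n))"
proof -
  have "inner (diag_matrix (\<lambda>n. complex_of_real (d n)) $ i $ j) (X $ i $ j)
      = (if i = j then d i * Re (X $ i $ i) else 0)" for i j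
    by (simp add: diag_matrix_def inner_complex_def)
  then show ?thesis
    by (simp add: inner_vec_def)
qed

section \<open>Semidefiniteness, feasibility and the Hermitian part\<close>

lemma psd_matrix_alt:
  "psd_matrix X \<longleftrightarrow> adjoint_matrix X = X \<and> (\<forall>z. 0 \<le> inner z (X *v z))"
  unfolding psd_matrix_def inner_vec_def inner_complex_eq_Re by (simp only: Re_sum)

lemma psd_matrix_congruence:
  fixes W :: "complex^'n^'n"
  assumes "psd_matrix X"
  shows "psd_matrix (W ** X ** adjoint_matrix W)"
proof -
  have "inner z (W ** X ** adjoint_matrix W *v z)
      = inner (adjoint_matrix W *v z) (X *v (adjoint_matrix W *v z))" for z
    by (simp add: inner_matrix_vector_left matrix_vector_mul_assoc matrix_mul_assoc)
  with assms show ?thesis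
    by (simp add: psd_matrix_alt adjoint_matrix_mult matrix_mul_assoc)
qed

lemma psd_diag_matrix:
  fixes d :: "'n::finite \<Rightarrow> real"
  assumes "\<And>n. d n \<ge> 0"
  shows "psd_matrix (diag_matrix (\<lambda>n. complex_of_real (d n)))"
proof -
  have "(diag_matrix (\<lambda>n. complex_of_real (d n)) *v z) $ i = d i *\<^sub>R z $ i" for z and i :: 'n
    by (simp add: matrix_vector_mult_def diag_matrix_def scaleR_conv_of_real
        if_distrib[of "\<lambda>a. a * _"] cong: if_cong)
  with assms show ?thesis
    by (auto simp: psd_matrix_alt inner_vec_def intro!: sum_nonneg)
qed

lemma psd_matrix_diag_nonneg:
  fixes X :: "complex^'n^'n"
  assumes "psd_matrix X"
  shows "Re (X $ n $ n) \<ge> 0"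
proof -
  \<comment> \<open>A diagonal entry is the quadratic form evaluated at a coordinate vector.\<close>
  have "(X *v axis n 1) $ n = X $ n $ n"
    by (simp add: matrix_vector_mult_def axis_def if_distrib[of "\<lambda>a. _ * a"] cong: if_cong)
  then have "inner (axis n 1) (X *v axis n 1) = Re (X $ n $ n)"
    by (simp add: inner_axis' inner_complex_def)
  with assms show ?thesis
    by (metis psd_matrix_alt)
qed

lemma feasible_congruence:
  fixes U :: "complex^'n^'n"
  assumes "feasible P X" and "adjoint_matrix U ** U = mat 1"
  shows "feasible P (U ** X ** adjoint_matrix U)"
proof -
  have "trace (U ** X ** adjoint_matrix U) = trace X"
    by (metis assms(2) matrix_mul_assoc matrix_mul_lid trace_mul_sym)
  with assms psd_matrix_congruence show ?thesis
    by (auto simp: feasible_def)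
qed

text \<open>A matrix and its adjoint have the same inner product with a Hermitian \<open>H\<close>,
  and \<open>A_matrix\<close> averages the target with its adjoint.\<close>

lemma inner_A_matrix:
  assumes "adjoint_matrix H = H"
  shows "inner (A_matrix \<rho> V Z) H = inner (V + \<rho> *\<^sub>R Z) H"
proof -
  have "inner (adjoint_matrix M) H = inner M H" for M
    by (metis assms inner_adjoint_matrix)
  then show ?thesis
    by (simp add: A_matrix_def inner_add_left)
qed

section \<open>The water-filling vector\<close>

lemma exists_threshold:
  fixes y :: "'n::finite \<Rightarrow> real"
  assumes "P > 0" and "pos_sum y > P"
  shows "\<exists>\<tau>>0. (\<Sum>n\<in>UNIV. x_opt y P \<tau> n) = P"
proof -
  let ?g = "\<lambda>\<tau>. \<Sum>n\<in>UNIV. max (y n - \<tau>) 0"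
  have "max (y n) 0 \<le> pos_sum y" for n
    unfolding pos_sum_def by (rule member_le_sum) auto
  then have le: "y n \<le> pos_sum y" for n
    using max.boundedE by blast
  have g0: "?g 0 = pos_sum y"
    by (simp add: pos_sum_def)
  have gS: "?g (pos_sum y) = 0"
    using le by (intro sum.neutral) (auto simp: max_def)
  \<comment> \<open>The continuous \<open>?g\<close> equals \<open>pos_sum y > P\<close> at 0 and
    vanishes at \<open>pos_sum y\<close>, which bounds every \<open>y n\<close>. The strict
    inequality at 0 then excludes \<open>\<tau> = 0\<close>.\<close>
  obtain \<tau> where "0 \<le> \<tau>" "?g \<tau> = P"
    using IVT2'[of ?g "pos_sum y" P 0] g0 gS assms
    by (force intro!: continuous_intros)
  moreover from this have "\<tau> \<noteq> 0"
    using g0 assms by auto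
  ultimately show ?thesis
    using assms by (intro exI[of _ \<tau>]) (auto simp: x_opt_def)
qed

lemma x_opt_nonneg: "x_opt y P \<tau> n \<ge> 0"
  by (simp add: x_opt_def)

lemma x_opt_sum_le:
  assumes "pos_sum y > P \<longrightarrow> \<tau> > 0 \<and> (\<Sum>n\<in>UNIV. x_opt y P \<tau> n) = P"
  shows "(\<Sum>n\<in>UNIV. x_opt y P \<tau> n) \<le> P"
proof (cases "pos_sum y > P")
  case False
  then show ?thesis
    by (simp add: x_opt_def pos_sum_def)
qed (use assms in simp)

text \<open>The first-order condition for projecting \<open>y\<close> onto the nonnegative vectors
  of sum at most \<open>P\<close>; \<tau> acts as the Lagrange multiplier of the budget.\<close>

lemma x_opt_variational:
  fixes y w :: "'n::finite \<Rightarrow> real"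
  assumes "pos_sum y > P \<longrightarrow> \<tau> > 0 \<and> (\<Sum>n\<in>UNIV. x_opt y P \<tau> n) = P"
    and w: "\<And>n. w n \<ge> 0" "(\<Sum>n\<in>UNIV. w n) \<le> P"
  shows "0 \<le> (\<Sum>n\<in>UNIV. (y n - x_opt y P \<tau> n) * (x_opt y P \<tau> n - w n))"
proof (cases "pos_sum y > P")
  case True
  with assms have \<tau>: "\<tau> > 0" and sum: "(\<Sum>n\<in>UNIV. x_opt y P \<tau> n) = P"
    by auto
  \<comment> \<open>Complementary slackness: if \<open>y n > \<tau>\<close>, the first factor on the
    right is exactly \<tau>; otherwise it is \<open>y n \<le> \<tau>\<close>, while the second
    factor is \<open>- w n \<le> 0\<close>.\<close>
  have "\<tau> * (x_opt y P \<tau> n - w n) \<le> (y n - x_opt y P \<tau> n) * (x_opt y P \<tau> n - w n)" for n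
    using True w(1)[of n] by (auto simp: x_opt_def max_def intro: mult_right_mono)
  then have "(\<Sum>n\<in>UNIV. \<tau> * (x_opt y P \<tau> n - w n))
      \<le> (\<Sum>n\<in>UNIV. (y n - x_opt y P \<tau> n) * (x_opt y P \<tau> n - w n))"
    by (rule sum_mono)
  moreover have "(\<Sum>n\<in>UNIV. \<tau> * (x_opt y P \<tau> n - w n)) = \<tau> * (P - (\<Sum>n\<in>UNIV. w n))"
    by (simp add: sum_distrib_left[symmetric] sum_subtractf sum)
  moreover have "0 \<le> \<tau> * (P - (\<Sum>n\<in>UNIV. w n))"
    using \<tau> w(2) by simp
  ultimately show ?thesis
    by linarith
next
  case False
  \<comment> \<open>Each term is nonnegative: it is 0 if \<open>y n \<ge> 0\<close>, and
    \<open>y n * (- w n)\<close> if \<open>y n < 0\<close>.\<close>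
  then show ?thesis
    using w(1) by (auto simp: x_opt_def max_def mult_nonpos_nonneg intro!: sum_nonneg)
qed

section \<open>From the variational inequality to the unique minimiser\<close>

lemma objective_gap:
  fixes V Z X X\<^sub>0 :: "complex^'n^'n"
  assumes "adjoint_matrix (X\<^sub>0 - X) = X\<^sub>0 - X"
    and "0 \<le> inner (A_matrix \<rho> V Z - X\<^sub>0) (X\<^sub>0 - X)"
  shows "objective \<rho> V Z X\<^sub>0 + (norm (X\<^sub>0 - X))\<^sup>2 \<le> objective \<rho> V Z X"
proof -
  let ?B = "V + \<rho> *\<^sub>R Z"
  have obj: "objective \<rho> V Z Y = (norm (?B - Y))\<^sup>2" for Y
    by (simp add: objective_def frobenius_norm_eq_norm algebra_simps)
  have "inner (?B - X\<^sub>0) (X\<^sub>0 - X) = inner (A_matrix \<rho> V Z - X\<^sub>0) (X\<^sub>0 - X)"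
    using inner_A_matrix[OF assms(1), of \<rho> V Z] by (simp add: inner_diff_left)
  with assms(2) have "0 \<le> inner (?B - X\<^sub>0) (X\<^sub>0 - X)"
    by simp
  \<comment> \<open>Expand the square of \<open>?B - X = (?B - X\<^sub>0) + (X\<^sub>0 - X)\<close>;
    the cross term is the inner product just shown to be nonnegative.\<close>
  moreover have "(norm (?B - X))\<^sup>2
      = (norm (?B - X\<^sub>0))\<^sup>2 + 2 * inner (?B - X\<^sub>0) (X\<^sub>0 - X) + (norm (X\<^sub>0 - X))\<^sup>2"
    using dot_norm[of "?B - X\<^sub>0" "X\<^sub>0 - X"] by (simp add: algebra_simps)
  ultimately show ?thesis
    by (simp add: obj)
qed

text \<open>The first conjunct ensures that the condition on \<tau> in the second can be met; the
  equivalence there covers attainment and uniqueness together.\<close>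

theorem proposition2:
  fixes V Z U :: "complex^'n^'n" and P \<rho> :: real and y :: "'n \<Rightarrow> real"
  assumes "P > 0" and "\<rho> > 0"
    and "unitary_matrix U"
    and "A_matrix \<rho> V Z =
           U ** diag_matrix (\<lambda>n. complex_of_real (y n)) ** adjoint_matrix U"
  shows "(pos_sum y > P \<longrightarrow> (\<exists>\<tau>>0. (\<Sum>n\<in>UNIV. x_opt y P \<tau> n) = P)) \<and>
    (\<forall>\<tau>. (pos_sum y > P \<longrightarrow> \<tau> > 0 \<and> (\<Sum>n\<in>UNIV. x_opt y P \<tau> n) = P) \<longrightarrow>
      (\<forall>X. is_arg_min (objective \<rho> V Z) (feasible P) X \<longleftrightarrow>
        X = U ** diag_matrix (\<lambda>n. complex_of_real (x_opt y P \<tau> n)) ** adjoint_matrix U))"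
proof (intro conjI impI allI)
  assume "pos_sum y > P"
  with assms(1) show "\<exists>\<tau>>0. (\<Sum>n\<in>UNIV. x_opt y P \<tau> n) = P"
    by (rule exists_threshold)
next
  fix \<tau> X
  assume \<tau>: "pos_sum y > P \<longrightarrow> \<tau> > 0 \<and> (\<Sum>n\<in>UNIV. x_opt y P \<tau> n) = P"
  define x where "x = x_opt y P \<tau>"
  let ?D = "\<lambda>d. diag_matrix (\<lambda>n. complex_of_real (d n)) :: complex^'n^'n"
  define X\<^sub>0 where "X\<^sub>0 = U ** ?D x ** adjoint_matrix U"
  have U: "adjoint_matrix U ** U = mat 1" "U ** adjoint_matrix U = mat 1"
    using assms(3) by (auto simp: unitary_matrix_def)
  have "feasible P (?D x)"
    using x_opt_sum_le[OF \<tau>] psd_diag_matrix[of x]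
    by (simp add: feasible_def trace_diag_matrix x_def x_opt_nonneg)
  then have feas: "feasible P X\<^sub>0"
    unfolding X\<^sub>0_def using U(1) by (rule feasible_congruence)
  have gap: "objective \<rho> V Z X\<^sub>0 + (norm (X\<^sub>0 - Y))\<^sup>2 \<le> objective \<rho> V Z Y" if "feasible P Y" for Y
  proof (rule objective_gap)
    show "adjoint_matrix (X\<^sub>0 - Y) = X\<^sub>0 - Y"
      using feas that by (simp add: feasible_def psd_matrix_def adjoint_matrix_diff)
    \<comment> \<open>\<open>W\<close> is the competitor \<open>Y\<close> written in the eigenbasis
      of \<open>A_matrix \<rho> V Z\<close>.\<close>
    define W where "W = adjoint_matrix U ** Y ** U"
    have W: "feasible P W"
      using feasible_congruence[OF that, of "adjoint_matrix U"] U by (simp add: W_def)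
    have "adjoint_matrix U ** X\<^sub>0 ** U = ?D x"
      by (metis U(1) X\<^sub>0_def matrix_mul_assoc matrix_mul_lid matrix_mul_rid)
    then have conj: "adjoint_matrix U ** (X\<^sub>0 - Y) ** U = ?D x - W"
      by (simp add: W_def congruence_diff)
    have "A_matrix \<rho> V Z - X\<^sub>0 = U ** (?D y - ?D x) ** adjoint_matrix U"
      by (simp add: assms(4) X\<^sub>0_def congruence_diff)
    moreover have "?D y - ?D x = ?D (\<lambda>n. y n - x n)"
      by (simp add: diag_matrix_def vec_eq_iff)
    ultimately have "inner (A_matrix \<rho> V Z - X\<^sub>0) (X\<^sub>0 - Y)
        = inner (?D (\<lambda>n. y n - x n)) (?D x - W)"
      by (simp only: inner_congruence conj)
    also have "\<dots> = (\<Sum>n\<in>UNIV. (y n - x n) * (x n - Re (W $ n $ n)))"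
      unfolding inner_diag_matrix by (simp add: diag_matrix_def)
    \<comment> \<open>The real diagonal of \<open>W\<close> is an admissible \<open>w\<close>:
      semidefiniteness gives its signs, the trace bound its sum.\<close>
    also have "\<dots> \<ge> 0"
      unfolding x_def using \<tau> W psd_matrix_diag_nonneg[of W]
      by (intro x_opt_variational) (auto simp: feasible_def trace_def)
    finally show "0 \<le> inner (A_matrix \<rho> V Z - X\<^sub>0) (X\<^sub>0 - Y)" .
  qed
  have "is_arg_min (objective \<rho> V Z) (feasible P) X \<longleftrightarrow> X = X\<^sub>0"
  proof
    assume "is_arg_min (objective \<rho> V Z) (feasible P) X"
    then have "feasible P X" "objective \<rho> V Z X \<le> objective \<rho> V Z X\<^sub>0"
      using feas by (auto simp: is_arg_min_def not_less)
    \<comment> \<open>The quadratic surplus in \<open>gap\<close> leaves a second minimiser no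
      distance from \<open>X\<^sub>0\<close>.\<close>
    with gap[of X] have "(norm (X\<^sub>0 - X))\<^sup>2 \<le> 0"
      by linarith
    then show "X = X\<^sub>0"
      by simp
  next
    assume "X = X\<^sub>0"
    with feas gap show "is_arg_min (objective \<rho> V Z) (feasible P) X"
      by (smt (verit) is_arg_min_def zero_le_power2)
  qed
  then show "is_arg_min (objective \<rho> V Z) (feasible P) X \<longleftrightarrow>
      X = U ** diag_matrix (\<lambda>n. complex_of_real (x_opt y P \<tau> n)) ** adjoint_matrix U"
    by (simp add: X\<^sub>0_def x_def)
qed

end
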